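(* There are infinitely many positive integers $n$ for which \[ \max \{ {\rm sfp}(n), {\rm sfp}(n+1), {\rm sfp}(n+2) \} < n^{1/3}. \]
   Context: For a positive integer $m$, ${\rm sfp}(m)$ (the squarefree part of $m$) denotes the smallest positive integer $a$ such that $a \mid m$ and $m/a$ is a perfect square. *)

theory Defs
  imports Complex_Main "HOL-Computational_Algebra.Computational_Algebra"
begin

(* Only meaningful for m > 0; the quotient m div a is exact because of a dvd m. *)
definition sfp :: "nat \<Rightarrow> nat" where
  "sfp m = (LEAST a. 0 < a \<and> a dvd m \<and> is_square (m div a))"

end

theory Submission
  imports Defs
begin

text \<open>
  The Chebyshev polynomial \<open>T = 4t\<^sup>3 - 3t\<close> satisfies \<open>T - 1 = (t - 1)(2t + 1)\<^sup>2\<close> and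
  \<open>T + 1 = (t + 1)(2t - 1)\<^sup>2\<close>, while \<open>T = t(4t\<^sup>2 - 3)\<close>. So for \<open>n = T - 1\<close>, which is about
  \<open>4t\<^sup>3\<close>, both \<open>n\<close> and \<open>n + 2\<close> have squarefree part at most \<open>t + 1\<close>. The
  Pell-type equation \<open>4t\<^sup>2 - 3 = 13s\<^sup>2\<close> has infinitely many solutions with \<open>16\<close> dividing \<open>t\<close>, and
  for these \<open>n + 1 = 13(t/16)(4s)\<^sup>2\<close> has squarefree part at most \<open>13t/16\<close>.
\<close>

lemma sfp_mult_square_le:
  assumes "0 < a" and "0 < k"
  shows "sfp (a * k\<^sup>2) \<le> a"
  unfolding sfp_def using assms by (intro Least_le) auto

text \<open>
  The multiplier is \<open>(649 + 180\<surd>13)\<^sup>8 = P + 32q\<surd>13\<close>, a power of a norm-one unit whose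
  \<open>\<surd>13\<close>-coefficient is divisible by \<open>32\<close>, so that \<open>32\<close> continues to divide \<open>2t = 32r\<close>.
\<close>
lemma pell_solution_unbounded:
  "\<exists>r s :: nat. N < r \<and> 0 < s \<and> 1024 * r\<^sup>2 = 13 * s\<^sup>2 + 3"
proof (induction N)
  case 0
  have "1024 * 8\<^sup>2 = 13 * 71\<^sup>2 + (3 :: nat)"
    by simp
  then show ?case
    by (metis zero_less_numeral)
next
  case (Suc N)
  then obtain r s :: nat
    where rs: "N < r" "0 < s" "1024 * r\<^sup>2 = 13 * s\<^sup>2 + 3"
    by blast
  define P q :: nat where "P = 4028705132934095091878401" and "q = 34917555121439536289205"
  have unit: "P\<^sup>2 = 13312 * q\<^sup>2 + 1" and pos: "0 < P" "0 < q"
    by (simp_all add: P_def q_def)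
  \<comment> \<open>Multiplicativity of the norm: these are the coefficients of
    \<open>(32r + s\<surd>13)(P + 32q\<surd>13)\<close>.\<close>
  have "int (1024 * (P * r + 13 * q * s)\<^sup>2) = int (13 * (1024 * q * r + P * s)\<^sup>2 + 3)"
  proof -
    have "(int P)\<^sup>2 = 13312 * (int q)\<^sup>2 + 1" "1024 * (int r)\<^sup>2 = 13 * (int s)\<^sup>2 + 3"
      using arg_cong[OF unit, of int] arg_cong[OF rs(3), of int] by simp_all
    then show ?thesis
      by simp algebra
  qed
  then have "1024 * (P * r + 13 * q * s)\<^sup>2 = 13 * (1024 * q * r + P * s)\<^sup>2 + 3"
    by (simp only: of_nat_eq_iff)
  moreover have "r < P * r + 13 * q * s"
  proof -
    have "1 * r \<le> P * r" using pos by (intro mult_right_mono) auto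
    moreover have "0 < 13 * q * s" using pos rs by simp
    ultimately show ?thesis by linarith
  qed
  moreover have "0 < 1024 * q * r + P * s"
    using pos rs by simp
  ultimately show ?case
    using rs(1) by (meson Suc_lessI less_trans_Suc order_le_less_trans Suc_leI)
qed

text \<open>With \<open>t = 16r\<close> the three bounds are \<open>t - 1\<close>,
  \<open>13t/16\<close> and \<open>t + 1\<close>; the cube of the largest is still below
  \<open>n\<close>, which is about \<open>4t^3\<close>.\<close>

lemma max_sfp_less_cbrt:
  fixes r s :: nat
  assumes "0 < r" "0 < s" and pell: "1024 * r\<^sup>2 = 13 * s\<^sup>2 + 3"
  defines "n \<equiv> (16 * r - 1) * (32 * r + 1)\<^sup>2"
  shows "real (Max {sfp n, sfp (n + 1), sfp (n + 2)}) < real n powr (1 / 3)"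
proof -
  define t where "t = int (16 * r)"
  have t: "16 \<le> t" using assms(1) by (simp add: t_def)
  have n: "int n = (t - 1) * (2 * t + 1)\<^sup>2"
    using assms(1) by (simp add: n_def t_def of_nat_diff)
  have "int (n + 1) = int (13 * r * (4 * s)\<^sup>2)"
  proof -
    have "13 * (int s)\<^sup>2 = 4 * t\<^sup>2 - 3"
      using arg_cong[OF pell, of int] by (simp add: t_def power_mult_distrib)
    moreover have "int (13 * r * (4 * s)\<^sup>2) = t * (13 * (int s)\<^sup>2)"
      by (simp add: t_def power2_eq_square)
    moreover have "int (n + 1) = t * (4 * t\<^sup>2 - 3)"
      using n by (simp add: power2_eq_square algebra_simps)
    ultimately show ?thesis
      by (simp only:)
  qed
  then have n1: "n + 1 = (13 * r) * (4 * s)\<^sup>2"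
    by (simp only: of_nat_eq_iff)
  have "int (n + 2) = int ((16 * r + 1) * (32 * r - 1)\<^sup>2)"
  proof -
    have "int (32 * r - 1) = 2 * t - 1" "int (16 * r + 1) = t + 1"
      using assms(1) by (simp_all add: t_def of_nat_diff)
    then have "int ((16 * r + 1) * (32 * r - 1)\<^sup>2) = (t + 1) * (2 * t - 1)\<^sup>2"
      by (simp only: of_nat_mult of_nat_power)
    moreover have "int (n + 2) = (t + 1) * (2 * t - 1)\<^sup>2"
      using n by (simp add: power2_eq_square algebra_simps)
    ultimately show ?thesis
      by (simp only:)
  qed
  then have n2: "n + 2 = (16 * r + 1) * (32 * r - 1)\<^sup>2"
    by (simp only: of_nat_eq_iff)
  have "sfp n \<le> 16 * r - 1"
    unfolding n_def using assms(1) by (intro sfp_mult_square_le) auto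
  moreover have "sfp (n + 1) \<le> 13 * r"
    unfolding n1 using assms(1,2) by (intro sfp_mult_square_le) auto
  moreover have "sfp (n + 2) \<le> 16 * r + 1"
    unfolding n2 using assms(1) by (intro sfp_mult_square_le) auto
  ultimately have le: "Max {sfp n, sfp (n + 1), sfp (n + 2)} \<le> 16 * r + 1"
    by simp
  have "(t + 1) ^ 3 < int n"
  proof -
    \<comment> \<open>The right-hand side is \<open>n - (t + 1)^3\<close>, expanded.\<close>
    have "0 < 3 * t * (t * (t - 1) - 2) - 2"
    proof -
      have "16 * 15 \<le> t * (t - 1)" using t by (intro mult_mono) auto
      then have "48 * 1 \<le> (3 * t) * (t * (t - 1) - 2)" using t by (intro mult_mono) auto
      then show ?thesis by simp
    qed
    then show ?thesis
      unfolding n by (simp add: power2_eq_square power3_eq_cube algebra_simps)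
  qed
  then have "int ((16 * r + 1) ^ 3) < int n"
    by (simp add: t_def add.commute)
  then have cube: "real (16 * r + 1) ^ 3 < real n"
    by (metis of_nat_less_iff of_nat_power)
  have "real (16 * r + 1) = (real (16 * r + 1) ^ 3) powr (1 / 3)"
    by (simp add: powr_powr flip: powr_numeral)
  also have "\<dots> < real n powr (1 / 3)"
    using cube by (intro powr_less_mono2) auto
  finally show ?thesis
    using le by (meson of_nat_le_iff order_le_less_trans)
qed

theorem theorem2:
  shows "infinite {n::nat. n > 0 \<and>
    real (Max {sfp n, sfp (n + 1), sfp (n + 2)}) < real n powr (1 / 3)}"
  unfolding infinite_nat_iff_unbounded
proof
  fix N :: nat
  obtain r s :: nat where rs: "N < r" "0 < s" "1024 * r\<^sup>2 = 13 * s\<^sup>2 + 3"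
    using pell_solution_unbounded by blast
  define n where "n = (16 * r - 1) * (32 * r + 1)\<^sup>2"
  \<comment> \<open>Gives both \<open>n > N\<close> and \<open>n > 0\<close>.\<close>
  have "r * 1 \<le> n"
    unfolding n_def using rs(1) by (intro mult_mono) auto
  with rs max_sfp_less_cbrt[of r s]
  show "\<exists>n>N. n \<in> {n. n > 0 \<and>
      real (Max {sfp n, sfp (n + 1), sfp (n + 2)}) < real n powr (1 / 3)}"
    by (intro exI[of _ n]) (simp add: n_def)
qed

end
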